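(* There is a deterministic polynomial-time algorithm which, given value-oracle access to a $\Delta$-linear set function $f$ over $n$ items, makes $O(n)$ nonadaptive value queries and outputs a linear set function $h$ such that for every set $S\subseteq[n]$, $|h(S)-f(S)| = O\big(\Delta(1+\sqrt{\min\{|S|,\,n-|S|\}})\big)$.
   Context: A set function over $[n]$ is a map $f:2^{[n]}\to\mathbb{R}$; a value query on $S$ returns $f(S)$. Queries are nonadaptive if the set of queried sets is fixed before any answer is seen. A set function is linear if there are constants $c_0,\dots,c_n$ with $f(S)=c_0+\sum_{i\in S}c_i$ for all $S$; it is $\Delta$-linear if there is a linear set function $\ell$ with $|f(S)-\ell(S)|\le\Delta$ for all $S$. The hidden constants in the $O(\cdot)$ notation are absolute. *)

theory Defs
  imports
    Complex_Main
    "HOL-Computational_Algebra.Polynomial"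
    "HOL-Library.Landau_Symbols"
begin

section \<open>Set functions\<close>

text \<open>The item set is \<open>[n] = {1..n}\<close>. A set function over \<open>[n]\<close> is a function on \<open>nat set\<close> of which
  only the values on subsets of \<open>{1..n}\<close> are ever used.\<close>

definition linear_set_function :: "nat \<Rightarrow> (nat set \<Rightarrow> real) \<Rightarrow> bool" where
  "linear_set_function n l \<longleftrightarrow>
     (\<exists>c :: nat \<Rightarrow> real. \<forall>S. S \<subseteq> {1..n} \<longrightarrow> l S = c 0 + (\<Sum>i\<in>S. c i))"

definition delta_linear :: "nat \<Rightarrow> real \<Rightarrow> (nat set \<Rightarrow> real) \<Rightarrow> bool" where
  "delta_linear n \<Delta> f \<longleftrightarrow>
     (\<exists>l. linear_set_function n l \<and> (\<forall>S. S \<subseteq> {1..n} \<longrightarrow> \<bar>f S - l S\<bar> \<le> \<Delta>))"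


section \<open>Random access machines with a value oracle\<close>

text \<open>A machine has two unbounded memories, one of natural numbers (counters, addresses, and
  characteristic vectors of sets) and one of real numbers (oracle answers and quantities derived
  from them). The field \<open>queries\<close> is the chronological list of the sets queried so far; it is
  bookkeeping which no instruction can read.

  All instructions and tests have unit cost. The instruction set is chosen so that this is
  polynomially equivalent to bit cost: natural numbers can be added and subtracted but not
  multiplied, so after \<open>t\<close> steps they have at most \<open>t + O(log n)\<close> bits; reals can be added,
  subtracted, and multiplied or divided by a natural number from memory, but not multiplied with
  each other, so after \<open>t\<close> steps every real in memory is an affine combination of the answers whose
  coefficients are rationals of bit length polynomial in \<open>t\<close> and \<open>log n\<close>. The only constants a
  program can contain are natural numbers. In particular, a program that runs in polynomial time here
  also does so on a real RAM and, when the answers are rationals, on a Turing machine.\<close>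

record state =
  nmem :: "nat \<Rightarrow> nat"
  rmem :: "nat \<Rightarrow> real"
  queries :: "nat set list"

text \<open>\<open>Dir k\<close> is the cell with address \<open>k\<close>; \<open>Ind k\<close> is the cell whose address is stored in cell \<open>k\<close> of
  the memory of natural numbers (indirect addressing).\<close>

datatype operand = Dir nat | Ind nat

fun loc :: "state \<Rightarrow> operand \<Rightarrow> nat" where
  "loc s (Dir k) = k"
| "loc s (Ind k) = nmem s k"

abbreviation nval :: "state \<Rightarrow> operand \<Rightarrow> nat" where
  "nval s a \<equiv> nmem s (loc s a)"

abbreviation rval :: "state \<Rightarrow> operand \<Rightarrow> real" where
  "rval s a \<equiv> rmem s (loc s a)"

abbreviation nset :: "state \<Rightarrow> operand \<Rightarrow> nat \<Rightarrow> state" where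
  "nset s a x \<equiv> s\<lparr>nmem := (nmem s)(loc s a := x)\<rparr>"

abbreviation rset :: "state \<Rightarrow> operand \<Rightarrow> real \<Rightarrow> state" where
  "rset s a x \<equiv> s\<lparr>rmem := (rmem s)(loc s a := x)\<rparr>"

datatype instr =
    NConst operand nat
  | NAdd operand operand operand
  | NSub operand operand operand
  | ROfNat operand operand
  | RAdd operand operand operand
  | RSub operand operand operand
  | RScale operand operand operand
  | RDivide operand operand operand
  | Query operand operand

datatype test = NLess operand operand | RLess operand operand

text \<open>The set queried by \<open>Query a b\<close> is read off as a characteristic vector from the \<open>n\<close> cells
  following the location of \<open>b\<close> in the memory of natural numbers.\<close>

definition queried_set :: "nat \<Rightarrow> state \<Rightarrow> operand \<Rightarrow> nat set" where
  "queried_set n s b = {i \<in> {1..n}. nmem s (loc s b + i) \<noteq> 0}"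

fun exec_instr :: "nat \<Rightarrow> (nat set \<Rightarrow> real) \<Rightarrow> instr \<Rightarrow> state \<Rightarrow> state" where
  "exec_instr n f (NConst a k) s = nset s a k"
| "exec_instr n f (NAdd a b c) s = nset s a (nval s b + nval s c)"
| "exec_instr n f (NSub a b c) s = nset s a (nval s b - nval s c)"
| "exec_instr n f (ROfNat a b) s = rset s a (real (nval s b))"
| "exec_instr n f (RAdd a b c) s = rset s a (rval s b + rval s c)"
| "exec_instr n f (RSub a b c) s = rset s a (rval s b - rval s c)"
| "exec_instr n f (RScale a b c) s = rset s a (rval s b * real (nval s c))"
| "exec_instr n f (RDivide a b c) s = rset s a (rval s b / real (nval s c))"
| "exec_instr n f (Query a b) s =
     (let S = queried_set n s b in (rset s a (f S))\<lparr>queries := queries s @ [S]\<rparr>)"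

fun holds :: "test \<Rightarrow> state \<Rightarrow> bool" where
  "holds (NLess a b) s \<longleftrightarrow> nval s a < nval s b"
| "holds (RLess a b) s \<longleftrightarrow> rval s a < rval s b"

datatype prog =
    Instr instr
  | Seq prog prog
  | If test prog prog
  | While test prog

text \<open>\<open>runs n f P s t s'\<close>: with oracle \<open>f\<close> over \<open>[n]\<close>, program \<open>P\<close> started in \<open>s\<close> halts after \<open>t\<close> steps
  in \<open>s'\<close>.\<close>

inductive runs :: "nat \<Rightarrow> (nat set \<Rightarrow> real) \<Rightarrow> prog \<Rightarrow> state \<Rightarrow> nat \<Rightarrow> state \<Rightarrow> bool"
  for n :: nat and f :: "nat set \<Rightarrow> real"
where
  Instr: "runs n f (Instr i) s 1 (exec_instr n f i s)"
| Seq: "runs n f P s t s' \<Longrightarrow> runs n f P' s' t' s'' \<Longrightarrow> runs n f (Seq P P') s (t + t') s''"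
| IfTrue: "holds b s \<Longrightarrow> runs n f P s t s' \<Longrightarrow> runs n f (If b P P') s (t + 1) s'"
| IfFalse: "\<not> holds b s \<Longrightarrow> runs n f P' s t s' \<Longrightarrow> runs n f (If b P P') s (t + 1) s'"
| WhileFalse: "\<not> holds b s \<Longrightarrow> runs n f (While b P) s 1 s"
| WhileTrue: "holds b s \<Longrightarrow> runs n f P s t s' \<Longrightarrow> runs n f (While b P) s' t' s'' \<Longrightarrow>
    runs n f (While b P) s (t + t' + 1) s''"

theorem runs_deterministic:
  "runs n f P s t s' \<Longrightarrow> runs n f P s u s'' \<Longrightarrow> u = t \<and> s'' = s'"
proof (induction arbitrary: u s'' rule: runs.induct)
  case (Instr i s)
  from Instr show ?case by cases simp
next
  case (Seq P s t s' P' t' s'')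
  from Seq.prems show ?case by cases (metis Seq.IH)
next
  case (IfTrue b s P t s' P')
  from IfTrue.prems show ?case by cases (use IfTrue.IH IfTrue.hyps in fastforce)+
next
  case (IfFalse b s P' t s' P)
  from IfFalse.prems show ?case by cases (use IfFalse.IH IfFalse.hyps in fastforce)+
next
  case (WhileFalse b s P)
  from WhileFalse.prems show ?case by cases (use WhileFalse.hyps in simp_all)
next
  case (WhileTrue b s P t s' t' s'')
  from WhileTrue.prems show ?case
  proof cases
    case WhileFalse
    with WhileTrue.hyps show ?thesis by simp
  next
    case (WhileTrue t1 r t2)
    with WhileTrue.IH show ?thesis by metis
  qed
qed

text \<open>The input is the number of items, in cell \<open>0\<close>.\<close>

definition initial_state :: "nat \<Rightarrow> state" where
  "initial_state n = \<lparr>nmem = (\<lambda>_. 0)(0 := n), rmem = (\<lambda>_. 0), queries = []\<rparr>"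

text \<open>The output is a linear set function, given by its constants \<open>c\<^sub>0, \<dots>, c\<^sub>n\<close> in the first \<open>n + 1\<close>
  cells of the memory of reals.\<close>

definition output_function :: "state \<Rightarrow> nat set \<Rightarrow> real" where
  "output_function s S = rmem s 0 + (\<Sum>i\<in>S. rmem s i)"

lemma linear_output_function: "linear_set_function n (output_function s)"
  unfolding linear_set_function_def output_function_def by blast

end

theory Submission
  imports Defs "HOL-Analysis.L2_Norm"
begin

text \<open>Take the least power of two \<open>N > n\<close> and query the sets \<open>S\<^sub>j = {i. w\<^sub>j(i) = 1}\<close> for the first \<open>N\<close>
  Walsh functions \<open>w\<^sub>j\<close>, besides \<open>{}\<close> and \<open>[n]\<close>. Since the columns of the \<open>N \<times> N\<close> Walsh matrix are
  orthogonal, correlating the answers with column \<open>i\<close> recovers the coefficient \<open>c\<^sub>i\<close> up to an error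
  \<open>e\<^sub>i\<close> which depends linearly on the noise, and by the Cauchy-Schwarz inequality
  \<open>\<bar>\<Sum>i\<in>S. e\<^sub>i\<bar> \<le> 2 \<Delta> \<surd>|S|\<close>. Shifting all the estimates by the same amount so that the value at \<open>[n]\<close> is
  exact changes the estimate on \<open>S\<close> by at most \<open>|S| \<sqdot> 4 \<Delta> / \<surd>n \<le> 4 \<Delta> \<surd>|S|\<close>. As the output is then
  exact both at \<open>{}\<close> and at \<open>[n]\<close>, the error on a large set is controlled by that on its complement.

  The program uses that the row of index \<open>j\<close>, where \<open>k\<close> is the largest power of two with \<open>k \<le> j\<close>,
  agrees with row \<open>j - k\<close> on the first \<open>k\<close> entries and is antiperiodic with antiperiod \<open>k\<close>.\<close>

section \<open>Walsh functions\<close>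

text \<open>The value is -1 to the number of positions at which both binary expansions have a 1: an
  entry of the Sylvester-Hadamard matrix.\<close>

fun walsh :: "nat \<Rightarrow> nat \<Rightarrow> real" where
  "walsh j i = (if j = 0 then 1
     else (if odd j \<and> odd i then -1 else 1) * walsh (j div 2) (i div 2))"

declare walsh.simps [simp del]

lemma walsh_0 [simp]: "walsh 0 i = 1"
  by (simp add: walsh.simps)

lemma walsh_0_right [simp]: "walsh j 0 = 1"
  by (induction j rule: less_induct) (subst walsh.simps, simp)

lemma walsh_double: "walsh (2 * j) i = walsh j (i div 2)"
  by (cases "j = 0") (simp_all add: walsh.simps[of "2 * j"])

lemma walsh_Suc_double: "walsh (Suc (2 * j)) i = (if odd i then -1 else 1) * walsh j (i div 2)"
  by (simp add: walsh.simps[of "Suc (2 * j)"])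

lemma walsh_eq_1_or: "walsh j i = 1 \<or> walsh j i = -1"
proof (induction j i rule: walsh.induct)
  case (1 j i)
  then show ?case by (cases "j = 0") (auto simp: walsh.simps[of j i])
qed

text \<open>\<open>i\<close> has no bit at position \<open>l\<close>, so deleting the top bit of
  \<open>j\<close> leaves the common bits unchanged.\<close>

lemma walsh_minus_top:
  "2 ^ l \<le> j \<Longrightarrow> j < 2 ^ Suc l \<Longrightarrow> i < 2 ^ l \<Longrightarrow> walsh j i = walsh (j - 2 ^ l) i"
proof (induction l arbitrary: j i)
  case 0
  then have "j = 1" "i = 0" by auto
  then show ?case by simp
next
  case (Suc l)
  then have "walsh (j div 2) (i div 2) = walsh (j div 2 - 2 ^ l) (i div 2)"
    by (intro Suc.IH) auto
  moreover have "j div 2 - 2 ^ l = (j - 2 ^ Suc l) div 2"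
    using Suc.prems by simp
  moreover have "odd (j - 2 ^ Suc l) = odd j"
    using Suc.prems by simp
  moreover have "j > 0"
    using Suc.prems(1) by (metis gr0I le_zero_eq power_not_zero zero_neq_numeral)
  ultimately show ?case
    using walsh.simps[of j i] walsh.simps[of "j - 2 ^ Suc l" i] by auto
qed

text \<open>Adding \<open>2 ^ l\<close> flips bit \<open>l\<close> of \<open>i\<close>, and any
  carry goes to positions above the top bit of \<open>j\<close>; so exactly one common bit appears
  or disappears.\<close>

lemma walsh_antiperiodic:
  "2 ^ l \<le> j \<Longrightarrow> j < 2 ^ Suc l \<Longrightarrow> walsh j (i + 2 ^ l) = - walsh j i"
proof (induction l arbitrary: j i)
  case 0
  then have "j = 1" by auto
  then show ?case by (simp add: walsh.simps[of "Suc 0"])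
next
  case (Suc l)
  then have "walsh (j div 2) (i div 2 + 2 ^ l) = - walsh (j div 2) (i div 2)"
    by (intro Suc.IH) auto
  moreover have "(i + 2 ^ Suc l) div 2 = i div 2 + 2 ^ l"
    by simp
  moreover have "j > 0"
    using Suc.prems(1) by (metis gr0I le_zero_eq power_not_zero zero_neq_numeral)
  ultimately show ?case
    using walsh.simps[of j i] walsh.simps[of j "i + 2 ^ Suc l"] by (auto simp: add.commute)
qed

lemma sum_lessThan_double:
  "(\<Sum>j<2 * (n::nat). g j) = (\<Sum>j<n. g (2 * j) + g (Suc (2 * j)) :: real)"
  by (induction n) auto

text \<open>Splitting the rows by parity pulls out the factor \<open>1 + ?e a * ?e b\<close>, which
  is 2 if the lowest bits of \<open>a\<close> and \<open>b\<close> agree and 0 otherwise; what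
  remains is the claim for the halved columns.\<close>

lemma walsh_orthogonal:
  "a < 2 ^ m \<Longrightarrow> b < 2 ^ m \<Longrightarrow>
    (\<Sum>j<2 ^ m. walsh j a * walsh j b) = (if a = b then 2 ^ m else 0)"
proof (induction m arbitrary: a b)
  case 0
  then show ?case by simp
next
  case (Suc m)
  let ?e = "\<lambda>a. if odd a then -1 else (1::real)"
  have "(\<Sum>j<2 ^ Suc m. walsh j a * walsh j b) =
      (\<Sum>j<2 ^ m. (1 + ?e a * ?e b) * (walsh j (a div 2) * walsh j (b div 2)))"
    unfolding power_Suc sum_lessThan_double
    by (intro sum.cong) (auto simp: walsh_double walsh_Suc_double)
  also have "\<dots> = (1 + ?e a * ?e b) * (\<Sum>j<2 ^ m. walsh j (a div 2) * walsh j (b div 2))"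
    by (rule sum_distrib_left[symmetric])
  also have "\<dots> = (1 + ?e a * ?e b) * (if a div 2 = b div 2 then 2 ^ m else 0)"
    using Suc.prems by (subst Suc.IH) auto
  also have "\<dots> = (if a = b then 2 ^ Suc m else 0)"
  proof -
    have "a = b \<longleftrightarrow> a div 2 = b div 2 \<and> odd a = odd b"
      by presburger
    then show ?thesis by auto
  qed
  finally show ?case .
qed

text \<open>Parseval: once the squares are expanded and summed over \<open>j\<close> first, only the
  diagonal pairs survive.\<close>

lemma walsh_sum_squares:
  assumes "S \<subseteq> {..<2 ^ m}"
  shows "(\<Sum>j<2 ^ m. (\<Sum>i\<in>S. walsh j i)\<^sup>2) = 2 ^ m * real (card S)"
proof -
  have fin: "finite S"
    using assms finite_subset by blast
  have "(\<Sum>j<2 ^ m. (\<Sum>i\<in>S. walsh j i)\<^sup>2) =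
      (\<Sum>a\<in>S. \<Sum>b\<in>S. \<Sum>j<2 ^ m. walsh j a * walsh j b)"
    unfolding power2_eq_square sum_product
    by (subst sum.swap, rule sum.cong[OF refl], rule sum.swap)
  also have "\<dots> = (\<Sum>a\<in>S. \<Sum>b\<in>S. if a = b then 2 ^ m else 0)"
    using assms by (intro sum.cong refl walsh_orthogonal) auto
  also have "\<dots> = 2 ^ m * real (card S)"
    using fin by simp
  finally show ?thesis .
qed

text \<open>Cauchy-Schwarz over the rows: the noise vector has norm at most
  \<open>sqrt (2 ^ m) * \<Delta>\<close>, the vector of row sums
  \<open>sqrt (2 ^ m * card S)\<close>. A termwise estimate would give \<open>card S\<close> in
  place of its square root.\<close>

lemma walsh_noise:
  assumes S: "S \<subseteq> {..<2 ^ m}" and \<eta>: "\<And>j. \<bar>\<eta> j\<bar> \<le> \<Delta>"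
  shows "\<bar>\<Sum>i\<in>S. \<Sum>j<2 ^ m. walsh j i * \<eta> j\<bar> \<le> 2 ^ m * (\<Delta> * sqrt (card S))"
proof -
  have \<Delta>: "0 \<le> \<Delta>"
    using \<eta>[of 0] by linarith
  have "(\<Sum>i\<in>S. \<Sum>j<2 ^ m. walsh j i * \<eta> j) = (\<Sum>j<2 ^ m. \<eta> j * (\<Sum>i\<in>S. walsh j i))"
    by (subst sum.swap) (simp add: sum_distrib_left mult.commute)
  also have "\<bar>\<dots>\<bar> \<le> (\<Sum>j<2 ^ m. \<bar>\<eta> j\<bar> * \<bar>\<Sum>i\<in>S. walsh j i\<bar>)"
    by (rule order_trans[OF sum_abs]) (simp add: abs_mult)
  also have "\<dots> \<le> L2_set (\<lambda>j. \<eta> j) {..<2 ^ m} * L2_set (\<lambda>j. \<Sum>i\<in>S. walsh j i) {..<2 ^ m}"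
    by (rule L2_set_mult_ineq)
  also have "\<dots> \<le> sqrt (2 ^ m * \<Delta>\<^sup>2) * sqrt (2 ^ m * card S)"
  proof (rule mult_mono)
    have "(\<Sum>j<2 ^ m. (\<eta> j)\<^sup>2) \<le> (\<Sum>j<(2::nat) ^ m. \<Delta>\<^sup>2)"
      using \<eta> by (intro sum_mono) (metis abs_le_square_iff abs_of_nonneg \<Delta>)
    then show "L2_set \<eta> {..<2 ^ m} \<le> sqrt (2 ^ m * \<Delta>\<^sup>2)"
      by (simp add: L2_set_def)
  qed (simp_all add: L2_set_def walsh_sum_squares[OF S] sum_nonneg)
  also have "\<dots> = 2 ^ m * (\<Delta> * sqrt (card S))"
    using \<Delta> by (simp add: real_sqrt_mult)
  finally show ?thesis .
qed

section \<open>Estimating the coefficients\<close>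

definition query_set :: "nat \<Rightarrow> nat \<Rightarrow> nat set" where
  "query_set n j = {i \<in> {1..n}. walsh j i = 1}"

lemma query_set_subset: "query_set n j \<subseteq> {1..n}"
  by (auto simp: query_set_def)

text \<open>Twice the indicator of \<open>walsh j i = 1\<close> is \<open>1 + walsh j i\<close>,
  hence the factor 2. Division by \<open>N\<close> is left to \<open>estimate\<close>, so that these
  are the sums which the program accumulates row by row.\<close>

definition correlation :: "nat \<Rightarrow> (nat set \<Rightarrow> real) \<Rightarrow> nat \<Rightarrow> nat \<Rightarrow> real" where
  "correlation n f N i = (\<Sum>j<N. walsh j i * (2 * f (query_set n j)))"

definition estimate :: "nat \<Rightarrow> (nat set \<Rightarrow> real) \<Rightarrow> nat \<Rightarrow> nat \<Rightarrow> real" where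
  "estimate n f N i = (correlation n f N i +
     (real N * (f {1..n} - f {}) - (\<Sum>i = 1..n. correlation n f N i)) / n) / N"

lemma correlation_linear:
  assumes n: "n < 2 ^ m" and i: "i \<in> {1..n}"
    and f: "\<And>S. S \<subseteq> {1..n} \<Longrightarrow> f S = c0 + (\<Sum>i\<in>S. c i) + \<eta> S"
  shows "correlation n f (2 ^ m) i =
    2 ^ m * c i + (\<Sum>j<2 ^ m. walsh j i * (2 * \<eta> (query_set n j)))"
proof -
  \<comment> \<open>The constant term is written as a multiple of column 0, which is orthogonal to
    column \<open>i\<close>; it thus drops out without being known.\<close>
  have *: "2 * f (query_set n j) = (2 * c0 + (\<Sum>i=1..n. c i)) * walsh j 0
      + (\<Sum>a=1..n. c a * walsh j a) + 2 * \<eta> (query_set n j)" for j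
  proof -
    have "2 * (\<Sum>i\<in>query_set n j. c i) = (\<Sum>i=1..n. if walsh j i = 1 then 2 * c i else 0)"
      unfolding query_set_def sum_distrib_left by (rule sum.inter_filter) simp
    also have "\<dots> = (\<Sum>i=1..n. c i + c i * walsh j i)"
    proof (rule sum.cong)
      show "(if walsh j i = 1 then 2 * c i else 0) = c i + c i * walsh j i" for i
        using walsh_eq_1_or[of j i] by auto
    qed simp
    finally show ?thesis
      by (subst f) (auto simp: query_set_def sum.distrib)
  qed
  have "correlation n f (2 ^ m) i =
      (\<Sum>j<2 ^ m. (2 * c0 + (\<Sum>i=1..n. c i)) * (walsh j i * walsh j 0)
        + (\<Sum>a=1..n. c a * (walsh j i * walsh j a)) + walsh j i * (2 * \<eta> (query_set n j)))"
    unfolding correlation_def *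
    by (simp add: algebra_simps sum_distrib_left)
  also have "\<dots> = (2 * c0 + (\<Sum>i=1..n. c i)) * (\<Sum>j<2 ^ m. walsh j i * walsh j 0)
      + (\<Sum>a=1..n. c a * (\<Sum>j<2 ^ m. walsh j i * walsh j a))
      + (\<Sum>j<2 ^ m. walsh j i * (2 * \<eta> (query_set n j)))"
    unfolding sum.distrib sum_distrib_left by (subst sum.swap[of _ "{1..n}"]) (rule refl)
  also have "(\<Sum>j<2 ^ m. walsh j i * walsh j 0) = 0"
    using n i by (subst walsh_orthogonal) auto
  also have "(\<Sum>a=1..n. c a * (\<Sum>j<2 ^ m. walsh j i * walsh j a)) = (\<Sum>a=1..n. if i = a then c a * 2 ^ m else 0)"
    using n i by (intro sum.cong refl, subst walsh_orthogonal) auto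
  also have "\<dots> = 2 ^ m * c i"
    using i by (simp add: sum.delta)
  finally show ?thesis by simp
qed

lemma sum_estimate:
  assumes "0 < n" "0 < N"
  shows "(\<Sum>i=1..n. estimate n f N i) = f {1..n} - f {}"
proof -
  have "(\<Sum>i=1..n. estimate n f N i) =
      ((\<Sum>i=1..n. correlation n f N i)
        + n * ((real N * (f {1..n} - f {}) - (\<Sum>i=1..n. correlation n f N i)) / n)) / N"
    by (simp add: estimate_def sum_divide_distrib[symmetric] sum.distrib)
  then show ?thesis
    using assms by simp
qed

text \<open>On \<open>S\<close> the error is a noise sum, at most
  \<open>2 * \<Delta> * sqrt (card S)\<close>, plus \<open>card S\<close> copies of a common shift
  \<open>d\<close>, at most twice as much.\<close>

lemma estimate_error:
  assumes n: "n < 2 ^ m" and S: "S \<subseteq> {1..n}"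
    and f: "\<And>S. S \<subseteq> {1..n} \<Longrightarrow> f S = c0 + (\<Sum>i\<in>S. c i) + \<eta> S"
    and \<eta>: "\<And>S. S \<subseteq> {1..n} \<Longrightarrow> \<bar>\<eta> S\<bar> \<le> \<Delta>"
  shows "\<bar>\<Sum>i\<in>S. estimate n f (2 ^ m) i - c i\<bar> \<le> 6 * \<Delta> * sqrt (card S)"
proof (cases "n = 0")
  case True
  then show ?thesis using S by simp
next
  case False
  define N :: real where "N = 2 ^ m"
  have N: "N > 0" by (simp add: N_def)
  have \<Delta>: "0 \<le> \<Delta>"
    using \<eta>[of "{}"] by simp
  define e where "e i = (\<Sum>j<2 ^ m. walsh j i * (2 * \<eta> (query_set n j))) / N" for i
  define d where "d = (f {1..n} - f {} - (\<Sum>i=1..n. c i) - (\<Sum>i=1..n. e i)) / n"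
  have corr: "correlation n f (2 ^ m) i = N * (c i + e i)" if "i \<in> {1..n}" for i
    using correlation_linear[OF n that f] N by (simp add: e_def N_def distrib_left)
  have est: "estimate n f (2 ^ m) i - c i = e i + d" if "i \<in> {1..n}" for i
  proof -
    have "(\<Sum>i=1..n. correlation n f (2 ^ m) i) = N * ((\<Sum>i=1..n. c i) + (\<Sum>i=1..n. e i))"
      by (simp add: corr sum_distrib_left[symmetric] sum.distrib)
    then show ?thesis
      unfolding estimate_def corr[OF that] d_def
      using N by (simp add: N_def field_simps)
  qed
  have noise: "\<bar>\<Sum>i\<in>T. e i\<bar> \<le> 2 * \<Delta> * sqrt (card T)" if "T \<subseteq> {1..n}" for T
  proof -
    have "T \<subseteq> {..<2 ^ m}"
      using that n by force
    moreover have "\<bar>2 * \<eta> (query_set n j)\<bar> \<le> 2 * \<Delta>" for j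
      using \<eta>[of "query_set n j"] query_set_subset by (simp add: abs_mult)
    ultimately have "\<bar>\<Sum>i\<in>T. \<Sum>j<2 ^ m. walsh j i * (2 * \<eta> (query_set n j))\<bar>
        \<le> N * (2 * \<Delta> * sqrt (card T))"
      unfolding N_def by (rule walsh_noise)
    then show ?thesis
      using N by (simp add: e_def sum_divide_distrib[symmetric] abs_divide field_simps)
  qed
  \<comment> \<open>The coefficients cancel between the two ends, so only noise is left in
    \<open>d\<close>.\<close>
  have "real n * \<bar>d\<bar> = \<bar>(\<eta> {1..n} - \<eta> {}) - (\<Sum>i=1..n. e i)\<bar>"
    using False f[of "{1..n}"] f[of "{}"] by (simp add: d_def abs_divide)
  also have "\<dots> \<le> 2 * \<Delta> + 2 * \<Delta> * sqrt n"
    using noise[of "{1..n}"] \<eta>[of "{1..n}"] \<eta>[of "{}"] by simp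
  \<comment> \<open>For positive \<open>n\<close>, \<open>sqrt n\<close> is at least 1.\<close>
  also have "\<dots> \<le> 4 * \<Delta> * sqrt n"
    using mult_left_mono[of 1 "sqrt n" "2 * \<Delta>"] \<Delta> False by simp
  finally have "sqrt n * (sqrt n * \<bar>d\<bar>) \<le> sqrt n * (4 * \<Delta>)"
    by (simp add: mult.left_commute[of "sqrt n"] mult.commute)
  then have d: "sqrt n * \<bar>d\<bar> \<le> 4 * \<Delta>"
    using False by simp
  have "card S \<le> n"
    using card_mono[OF _ S] by simp
  \<comment> \<open>One of the two factors \<open>sqrt (card S)\<close> is raised to
    \<open>sqrt n\<close>, to which the bound on \<open>d\<close> applies.\<close>
  have "\<bar>card S * d\<bar> = sqrt (card S) * (sqrt (card S) * \<bar>d\<bar>)"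
    by (simp add: abs_mult mult.assoc[symmetric])
  also have "\<dots> \<le> sqrt (card S) * (sqrt n * \<bar>d\<bar>)"
    using \<open>card S \<le> n\<close> by (intro mult_left_mono mult_right_mono) auto
  also have "\<dots> \<le> sqrt (card S) * (4 * \<Delta>)"
    using d by (intro mult_left_mono) auto
  finally have cd: "\<bar>card S * d\<bar> \<le> sqrt (card S) * (4 * \<Delta>)" .
  have "(\<Sum>i\<in>S. estimate n f (2 ^ m) i - c i) = (\<Sum>i\<in>S. e i + d)"
    using S by (intro sum.cong est) auto
  then have "(\<Sum>i\<in>S. estimate n f (2 ^ m) i - c i) = (\<Sum>i\<in>S. e i) + card S * d"
    by (simp add: sum.distrib)
  then show ?thesis
    using noise[OF S] cd by (simp add: algebra_simps)
qed

lemma approximation_error: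
  assumes n: "n < 2 ^ m" and S: "S \<subseteq> {1..n}" and \<Delta>: "delta_linear n \<Delta> f"
  shows "\<bar>f {} + (\<Sum>i\<in>S. estimate n f (2 ^ m) i) - f S\<bar>
    \<le> 6 * (\<Delta> * (1 + sqrt (min (real (card S)) (real n - real (card S)))))"
proof -
  obtain c where c: "\<And>S. S \<subseteq> {1..n} \<Longrightarrow> \<bar>f S - (c 0 + (\<Sum>i\<in>S. c i))\<bar> \<le> \<Delta>"
    using \<Delta> unfolding delta_linear_def linear_set_function_def by metis
  define \<eta> where "\<eta> S = f S - (c 0 + (\<Sum>i\<in>S. c i))" for S
  have f: "f S = c 0 + (\<Sum>i\<in>S. c i) + \<eta> S" for S
    by (simp add: \<eta>_def)
  have \<eta>: "S \<subseteq> {1..n} \<Longrightarrow> \<bar>\<eta> S\<bar> \<le> \<Delta>" for S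
    using c by (simp add: \<eta>_def)
  have err: "\<bar>(\<Sum>i\<in>T. estimate n f (2 ^ m) i) - (\<Sum>i\<in>T. c i)\<bar> \<le> 6 * \<Delta> * sqrt (card T)"
    if "T \<subseteq> {1..n}" for T
    using estimate_error[OF n that f \<eta>] by (simp add: sum_subtractf)
  have \<Delta>0: "0 \<le> \<Delta>"
    using \<eta>[of "{}"] by simp
  define T where "T = {1..n} - S"
  have fin: "finite S" using S finite_subset by blast
  have cardT: "real (card T) = real n - real (card S)"
    using S card_mono[OF _ S] by (simp add: T_def card_Diff_subset fin of_nat_diff)
  have small: "\<bar>f {} + (\<Sum>i\<in>S. estimate n f (2 ^ m) i) - f S\<bar> \<le> 6 * (\<Delta> * (1 + sqrt (card S)))"
    using err[OF S] \<eta>[OF S] \<eta>[of "{}"] f[of S] f[of "{}"] \<Delta>0 by (simp add: algebra_simps)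
  have large: "\<bar>f {} + (\<Sum>i\<in>S. estimate n f (2 ^ m) i) - f S\<bar> \<le> 6 * (\<Delta> * (1 + sqrt (card T)))"
  proof (cases "n = 0")
    case True
    then show ?thesis using S small by (simp add: T_def)
  next
    case False
    have split: "(\<Sum>i=1..n. g i) = (\<Sum>i\<in>S. g i) + (\<Sum>i\<in>T. g i)" for g :: "nat \<Rightarrow> real"
      using sum.subset_diff[OF S, of g] by (simp add: T_def add.commute)
    have "T \<subseteq> {1..n}" by (auto simp: T_def)
    \<comment> \<open>Exactness at \<open>{1..n}\<close> turns the sum of estimates over
      \<open>S\<close> into \<open>f {1..n} - f {}\<close> minus the sum over \<open>T\<close>, so
      \<open>f {}\<close> cancels and two noise values remain, as in \<open>small\<close>.\<close>
    from err[OF this] show ?thesis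
      using sum_estimate[of n "2 ^ m" f] False split[of "estimate n f (2 ^ m)"] split[of c]
        \<eta>[OF S] \<eta>[of "{1..n}"] f[of S] f[of "{1..n}"] \<Delta>0
      by (simp add: algebra_simps)
  qed
  show ?thesis
    using small large unfolding cardT by (simp add: min_def)
qed

section \<open>Total correctness within a time bound\<close>

text \<open>Since \<open>runs\<close> is deterministic, the run claimed to exist is the only halting
  one.\<close>

definition reaches ::
    "nat \<Rightarrow> (nat set \<Rightarrow> real) \<Rightarrow> prog \<Rightarrow> state \<Rightarrow> nat \<Rightarrow> (state \<Rightarrow> bool) \<Rightarrow> bool" where
  "reaches n f P s T Q \<longleftrightarrow> (\<exists>t s'. runs n f P s t s' \<and> t \<le> T \<and> Q s')"

lemma reaches_mono:
  "reaches n f P s T Q \<Longrightarrow> T \<le> T' \<Longrightarrow> (\<And>s'. Q s' \<Longrightarrow> Q' s') \<Longrightarrow> reaches n f P s T' Q'"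
  unfolding reaches_def by (meson order_trans)

lemma reaches_Seq:
  assumes "reaches n f P s T R" "\<And>s'. R s' \<Longrightarrow> reaches n f P' s' T' Q"
  shows "reaches n f (Seq P P') s (T + T') Q"
  using assms unfolding reaches_def by (meson runs.Seq add_mono)

text \<open>The index of \<open>I\<close> counts iterations and so doubles as the termination
  measure. Each iteration pays 1 for its test; the last 1 is the failing test.\<close>

lemma reaches_While:
  assumes "I a s" "a \<le> m"
    and "\<And>k s. a \<le> k \<Longrightarrow> k < m \<Longrightarrow> I k s \<Longrightarrow> holds b s \<and> reaches n f P s T (I (Suc k))"
    and "\<And>s. I m s \<Longrightarrow> \<not> holds b s"
  shows "reaches n f (While b P) s ((m - a) * (T + 1) + 1) (I m)"
  using assms(2,1,3)
proof (induction a arbitrary: s rule: inc_induct)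
  case base
  then show ?case
    unfolding reaches_def using assms(4) runs.WhileFalse by force
next
  case (step a)
  then have b: "holds b s" and "reaches n f P s T (I (Suc a))"
    by auto
  then obtain t s' where *: "runs n f P s t s'" "t \<le> T" "I (Suc a) s'"
    unfolding reaches_def by blast
  have "reaches n f (While b P) s' ((m - Suc a) * (T + 1) + 1) (I m)"
    by (rule step.IH[OF *(3)]) (use step.prems(2) Suc_leD in blast)
  then obtain t' s'' where **: "runs n f (While b P) s' t' s''"
      "t' \<le> (m - Suc a) * (T + 1) + 1" "I m s''"
    unfolding reaches_def by blast
  have "m - a = Suc (m - Suc a)"
    using step.hyps by simp
  then have "t + t' + 1 \<le> (m - a) * (T + 1) + 1"
    using *(2) **(2) by simp
  then show ?case
    unfolding reaches_def using runs.WhileTrue[OF b *(1) **(1)] **(3) by blast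
qed

primrec loop_free :: "prog \<Rightarrow> bool" where
  "loop_free (Instr i) \<longleftrightarrow> True"
| "loop_free (Seq P P') \<longleftrightarrow> loop_free P \<and> loop_free P'"
| "loop_free (If b P P') \<longleftrightarrow> loop_free P \<and> loop_free P'"
| "loop_free (While b P) \<longleftrightarrow> False"

primrec duration :: "prog \<Rightarrow> nat" where
  "duration (Instr i) = 1"
| "duration (Seq P P') = duration P + duration P'"
| "duration (If b P P') = max (duration P) (duration P') + 1"
| "duration (While b P) = 0"

primrec effect :: "nat \<Rightarrow> (nat set \<Rightarrow> real) \<Rightarrow> prog \<Rightarrow> state \<Rightarrow> state" where
  "effect n f (Instr i) s = exec_instr n f i s"
| "effect n f (Seq P P') s = effect n f P' (effect n f P s)"
| "effect n f (If b P P') s = (if holds b s then effect n f P s else effect n f P' s)"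
| "effect n f (While b P) s = s"

lemma runs_effect: "loop_free P \<Longrightarrow> \<exists>t\<le>duration P. runs n f P s t (effect n f P s)"
proof (induction P arbitrary: s)
  case (Instr i)
  then show ?case using runs.Instr by force
next
  case (Seq P P')
  then show ?case
    using runs.Seq by (metis add_mono duration.simps(2) effect.simps(2) loop_free.simps(2))
next
  case (If b P P')
  show ?case
  proof (cases "holds b s")
    case True
    from If obtain t where "t \<le> duration P" "runs n f P s t (effect n f P s)" by force
    with True show ?thesis
      using runs.IfTrue[of b s n f P t _ P'] by (intro exI[of _ "t + 1"]) auto
  next
    case False
    from If obtain t where "t \<le> duration P'" "runs n f P' s t (effect n f P' s)" by force
    with False show ?thesis
      using runs.IfFalse[of b s n f P' t _ P] by (intro exI[of _ "t + 1"]) auto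
  qed
qed simp

text \<open>The simplifier evaluates \<open>duration\<close> and \<open>effect\<close>, so verifying
  a loop body becomes symbolic execution.\<close>

lemma reaches_loop_free:
  "loop_free P \<Longrightarrow> duration P \<le> T \<Longrightarrow> Q (effect n f P s) \<Longrightarrow> reaches n f P s T Q"
  unfolding reaches_def using runs_effect by (meson order_trans)

abbreviation Then (infixr ";;" 60) where
  "P ;; P' \<equiv> Seq P P'"

section \<open>The program\<close>

text \<open>Natural-number cells: 0 holds \<open>n\<close>; 1 holds 1; 2 holds \<open>n + 1\<close>, which is both the row length and
  the address of the scratch cell for reals; 3 holds \<open>N\<close>; 4 and 5 hold the column and row indices
  \<open>i\<close> and \<open>j\<close>; 6 holds the largest power of two \<open>k \<le> j\<close>, or 0 if \<open>j = 0\<close>; 7 and 8 hold the addresses of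
  the rows \<open>j\<close> and \<open>j - k\<close>; 9 and 10 are scratch; 11 holds 0. Row \<open>j\<close> starts at cell \<open>20 + j * (n + 1)\<close>.\<close>

text \<open>For \<open>j = 0\<close> we have \<open>k = 0\<close>, so each entry is read before it is written, as \<open>0\<close>: row 0 becomes all
  ones, as it should.\<close>

definition fill_body :: prog where
  "fill_body =
    Instr (NAdd (Dir 9) (Dir 7) (Dir 4)) ;;
    If (NLess (Dir 4) (Dir 6))
      (Instr (NAdd (Dir 10) (Dir 8) (Dir 4)) ;;
       Instr (NAdd (Ind 9) (Ind 10) (Dir 11)))
      (Instr (NSub (Dir 10) (Dir 9) (Dir 6)) ;;
       Instr (NSub (Ind 9) (Dir 1) (Ind 10))) ;;
    Instr (NAdd (Dir 4) (Dir 4) (Dir 1))"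

definition fill :: prog where
  "fill = While (NLess (Dir 4) (Dir 2)) fill_body"

text \<open>Signs are stored as bits; branching between addition and subtraction replaces
  multiplication by -1.\<close>

definition correlate_body :: prog where
  "correlate_body =
    Instr (NAdd (Dir 9) (Dir 7) (Dir 4)) ;;
    If (NLess (Dir 11) (Ind 9))
      (Instr (RAdd (Ind 4) (Ind 4) (Ind 2)))
      (Instr (RSub (Ind 4) (Ind 4) (Ind 2))) ;;
    Instr (NAdd (Dir 4) (Dir 4) (Dir 1))"

definition correlate :: prog where
  "correlate = While (NLess (Dir 4) (Dir 2)) correlate_body"

text \<open>If \<open>j\<close> has reached twice the old \<open>k\<close>, it is itself the next
  power of two and copying restarts at row 0, in cell 20; otherwise row \<open>j - k\<close>
  advances with row \<open>j\<close>.\<close>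

definition start_row :: prog where
  "start_row =
    Instr (NAdd (Dir 10) (Dir 6) (Dir 6)) ;;
    If (NLess (Dir 5) (Dir 10))
      (Instr (NAdd (Dir 8) (Dir 8) (Dir 2)))
      (Instr (NAdd (Dir 6) (Dir 5) (Dir 11)) ;;
       Instr (NConst (Dir 8) 20)) ;;
    Instr (NConst (Dir 4) 0)"

text \<open>The doubling is the factor 2 of \<open>correlation\<close>. The column counter restarts
  at 1 because real cell 0 holds the value at \<open>{}\<close>.\<close>

definition query_row :: prog where
  "query_row =
    Instr (Query (Ind 2) (Ind 7)) ;;
    Instr (RAdd (Ind 2) (Ind 2) (Ind 2)) ;;
    Instr (NConst (Dir 4) 1)"

definition next_row :: prog where
  "next_row =
    Instr (NAdd (Dir 5) (Dir 5) (Dir 1)) ;;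
    Instr (NAdd (Dir 7) (Dir 7) (Dir 2))"

definition rows :: prog where
  "rows = While (NLess (Dir 5) (Dir 3)) (start_row ;; fill ;; query_row ;; correlate ;; next_row)"

definition total :: prog where
  "total = While (NLess (Dir 4) (Dir 2))
    (Instr (RSub (Ind 2) (Ind 2) (Ind 4)) ;;
     Instr (NAdd (Dir 4) (Dir 4) (Dir 1)))"

definition correct :: prog where
  "correct = While (NLess (Dir 4) (Dir 2))
    (Instr (RAdd (Ind 4) (Ind 4) (Ind 2)) ;;
     Instr (RDivide (Ind 4) (Ind 4) (Dir 3)) ;;
     Instr (NAdd (Dir 4) (Dir 4) (Dir 1)))"

definition powers :: prog where
  "powers = While (NLess (Dir 3) (Dir 2)) (Instr (NAdd (Dir 3) (Dir 3) (Dir 3)))"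

text \<open>The query of \<open>{}\<close> comes first, while the cells 2 to \<open>n + 1\<close>,
  which it reads, are still 0.\<close>

definition initialize :: prog where
  "initialize =
    Instr (Query (Dir 0) (Dir 1)) ;;
    Instr (NConst (Dir 1) 1) ;;
    Instr (NAdd (Dir 2) (Dir 0) (Dir 1)) ;;
    Instr (NConst (Dir 3) 1) ;;
    Instr (NConst (Dir 7) 20)"

text \<open>Row 0, stored from cell 20 on, is all ones and serves as the characteristic vector of
  \<open>{1..n}\<close>.\<close>

definition query_all :: prog where
  "query_all =
    Instr (Query (Ind 2) (Dir 20)) ;;
    Instr (RSub (Ind 2) (Ind 2) (Dir 0)) ;;
    Instr (RScale (Ind 2) (Ind 2) (Dir 3)) ;;
    Instr (NConst (Dir 4) 1)"

definition average :: prog where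
  "average =
    Instr (RDivide (Ind 2) (Ind 2) (Dir 0)) ;;
    Instr (NConst (Dir 4) 1)"

definition learner :: prog where
  "learner = initialize ;; powers ;; rows ;; query_all ;; total ;; average ;; correct"

section \<open>Correctness of the loops over the columns of one row\<close>

lemma reaches_fill:
  assumes s: "nmem s 1 = 1" "nmem s 2 = Suc n" "nmem s 4 = 0" "nmem s 6 = k" "nmem s 7 = p"
      "nmem s 8 = q" "nmem s 11 = 0"
    and q: "20 \<le> q" "20 \<le> p" "0 < k \<Longrightarrow> q + n < p"
    and copy: "\<And>i. i \<le> n \<Longrightarrow> i < k \<Longrightarrow> nmem s (q + i) = E i"
    and flip: "\<And>i. i \<le> n \<Longrightarrow> 0 < k \<Longrightarrow> k \<le> i \<Longrightarrow> E i = 1 - E (i - k)"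
    and init: "\<And>i. i \<le> n \<Longrightarrow> k = 0 \<Longrightarrow> nmem s (p + i) = 0 \<and> E i = 1"
  shows "reaches n f fill s (6 * Suc n + 1) (\<lambda>s'. rmem s' = rmem s \<and> queries s' = queries s \<and>
    (\<forall>i\<le>n. nmem s' (p + i) = E i) \<and>
    (\<forall>c. c \<noteq> 4 \<longrightarrow> c \<noteq> 9 \<longrightarrow> c \<noteq> 10 \<longrightarrow> c < p \<or> p + n < c \<longrightarrow> nmem s' c = nmem s c))"
proof -
  \<comment> \<open>The frame includes the part of the row not yet written, whose zeros are read
    when \<open>k = 0\<close>.\<close>
  define I where "I i s' \<longleftrightarrow> rmem s' = rmem s \<and> queries s' = queries s \<and> nmem s' 4 = i \<and>
    (\<forall>i'<i. nmem s' (p + i') = E i') \<and>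
    (\<forall>c. c \<noteq> 4 \<longrightarrow> c \<noteq> 9 \<longrightarrow> c \<noteq> 10 \<longrightarrow> c < p \<or> p + i \<le> c \<longrightarrow> nmem s' c = nmem s c)" for i and s' :: state
  have "reaches n f fill s ((Suc n - 0) * (5 + 1) + 1) (I (Suc n))"
    unfolding fill_def
  proof (rule reaches_While)
    show "I 0 s"
      using s by (simp add: I_def)
  next
    fix i s'
    assume i: "i < Suc n" and I: "I i s'"
    then have frame: "\<And>c. c \<noteq> 4 \<Longrightarrow> c \<noteq> 9 \<Longrightarrow> c \<noteq> 10 \<Longrightarrow> c < p \<or> p + i \<le> c \<Longrightarrow> nmem s' c = nmem s c"
      and filled: "\<And>i'. i' < i \<Longrightarrow> nmem s' (p + i') = E i'"
      and [simp]: "nmem s' 4 = i" "rmem s' = rmem s" "queries s' = queries s"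
      by (auto simp: I_def)
    have [simp]: "nmem s' (Suc 0) = 1" "nmem s' 2 = Suc n" "nmem s' 6 = k" "nmem s' 7 = p" "nmem s' 8 = q"
        "nmem s' 11 = 0"
      using s q by (simp_all add: frame)
    \<comment> \<open>Row \<open>q\<close> ends below \<open>p\<close>, so nothing written so far
      has touched it.\<close>
    have copy': "nmem s' (q + i) = E i" if "i < k"
      using that i q copy[of i] by (subst frame) auto
    have flip': "1 - nmem s' (p + i - k) = E i" if "\<not> i < k"
    proof (cases "k = 0")
      case True
      then show ?thesis using init[of i] i q by (simp add: frame)
    next
      case False
      then have "p + i - k = p + (i - k)" "i - k < i"
        using that by auto
      then have "nmem s' (p + i - k) = E (i - k)"
        using filled[of "i - k"] by metis
      then show ?thesis
        using flip[of i] False that i by simp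
    qed
    \<comment> \<open>The entry read lies at or beyond \<open>p\<close>, so the writes to scratch
      cells 9 and 10 do not change it.\<close>
    have ne: "p + i - k \<noteq> 10" "p + i - k \<noteq> 9" if "\<not> i < k"
      using that q by auto
    have "I (Suc i) (effect n f fill_body s')"
      using q frame filled copy' flip' ne
      by (cases "i < k") (auto simp: fill_body_def I_def less_Suc_eq)
    then show "holds (NLess (Dir 4) (Dir 2)) s' \<and> reaches n f fill_body s' 5 (I (Suc i))"
      using i by (auto intro!: reaches_loop_free simp: fill_body_def)
  next
    show "\<not> holds (NLess (Dir 4) (Dir 2)) s'" if "I (Suc n) s'" for s'
      using that s q by (simp add: I_def)
  qed simp
  then show ?thesis
    by (rule reaches_mono) (auto simp: I_def less_Suc_eq_le)
qed

lemma reaches_correlate: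
  assumes s: "nmem s 1 = 1" "nmem s 2 = Suc n" "nmem s 4 = 1" "nmem s 7 = p" "nmem s 11 = 0"
    and p: "20 \<le> p"
    and row: "\<And>i. i \<in> {1..n} \<Longrightarrow> w i = (if nmem s (p + i) = 0 then - 1 else 1)"
  shows "reaches n f correlate s (5 * n + 1) (\<lambda>s'. queries s' = queries s \<and>
    (\<forall>i\<in>{1..n}. rmem s' i = rmem s i + w i * rmem s (Suc n)) \<and> rmem s' 0 = rmem s 0 \<and>
    (\<forall>c. c \<noteq> 4 \<longrightarrow> c \<noteq> 9 \<longrightarrow> c \<noteq> 10 \<longrightarrow> nmem s' c = nmem s c))"
proof -
  \<comment> \<open>The frame on the reals protects cell 0 and the doubled answer in cell
    \<open>Suc n\<close>.\<close>
  define I where "I i s' \<longleftrightarrow> queries s' = queries s \<and> nmem s' 4 = i \<and>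
    (\<forall>i'\<in>{1..<i}. rmem s' i' = rmem s i' + w i' * rmem s (Suc n)) \<and>
    (\<forall>c. c = 0 \<or> i \<le> c \<longrightarrow> rmem s' c = rmem s c) \<and>
    (\<forall>c. c \<noteq> 4 \<longrightarrow> c \<noteq> 9 \<longrightarrow> c \<noteq> 10 \<longrightarrow> nmem s' c = nmem s c)" for i and s' :: state
  have "reaches n f correlate s ((Suc n - 1) * (4 + 1) + 1) (I (Suc n))"
    unfolding correlate_def
  proof (rule reaches_While)
    show "I 1 s"
      using s by (simp add: I_def)
  next
    fix i s'
    assume i: "1 \<le> i" "i < Suc n" and I: "I i s'"
    then have frame: "\<And>c. c \<noteq> 4 \<Longrightarrow> c \<noteq> 9 \<Longrightarrow> c \<noteq> 10 \<Longrightarrow> nmem s' c = nmem s c"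
      and rframe: "\<And>c. c = 0 \<or> i \<le> c \<Longrightarrow> rmem s' c = rmem s c"
      and processed: "\<And>i'. i' \<in> {1..<i} \<Longrightarrow> rmem s' i' = rmem s i' + w i' * rmem s (Suc n)"
      and [simp]: "nmem s' 4 = i" "queries s' = queries s"
      by (auto simp: I_def)
    have [simp]: "nmem s' (Suc 0) = 1" "nmem s' 2 = Suc n" "nmem s' 7 = p" "nmem s' 11 = 0"
        "nmem s' (p + i) = nmem s (p + i)"
      using s p by (simp_all add: frame)
    have "I (Suc i) (effect n f correlate_body s')"
      using i p frame rframe processed row[of i]
      by (cases "nmem s (p + i) = 0") (auto simp: correlate_body_def I_def less_Suc_eq)
    then show "holds (NLess (Dir 4) (Dir 2)) s' \<and> reaches n f correlate_body s' 4 (I (Suc i))"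
      using i by (auto intro!: reaches_loop_free simp: correlate_body_def)
  next
    show "\<not> holds (NLess (Dir 4) (Dir 2)) s'" if "I (Suc n) s'" for s'
      using that s by (simp add: I_def)
  qed simp
  then show ?thesis
    by (rule reaches_mono) (auto simp: I_def)
qed


section \<open>Walsh rows as bits, and the loop over the rows\<close>

definition walsh_bit :: "nat \<Rightarrow> nat \<Rightarrow> nat" where
  "walsh_bit j i = (if walsh j i = 1 then 1 else 0)"

definition top_power :: "nat \<Rightarrow> nat \<Rightarrow> bool" where
  "top_power j k \<longleftrightarrow> j = 0 \<and> k = 0 \<or> (\<exists>l. k = 2 ^ l \<and> k \<le> j \<and> j < 2 * k)"

text \<open>In the second case \<open>j < 2 * k\<close> forces \<open>Suc j = 2 * k\<close>, the
  next power of two; from \<open>j = k = 0\<close> the next index is 1.\<close>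

lemma top_power_Suc:
  assumes "top_power j k"
  shows "Suc j < 2 * k \<Longrightarrow> top_power (Suc j) k" "2 * k \<le> Suc j \<Longrightarrow> top_power (Suc j) (Suc j)"
proof -
  show "top_power (Suc j) k" if "Suc j < 2 * k"
    using assms that unfolding top_power_def by auto
  show "top_power (Suc j) (Suc j)" if "2 * k \<le> Suc j"
  proof (cases "k = 0")
    case True
    then show ?thesis
      using assms unfolding top_power_def by (auto intro: exI[of _ 0])
  next
    case False
    then obtain l where "k = 2 ^ l" "j < 2 * k"
      using assms unfolding top_power_def by auto
    then have "Suc j = 2 ^ Suc l"
      using that by simp
    then show ?thesis
      unfolding top_power_def by (intro disjI2 exI[of _ "Suc l"]) simp
  qed
qed

text \<open>These are the conditions \<open>copy\<close>, \<open>flip\<close> and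
  \<open>init\<close> of \<open>reaches_fill\<close> for the true row; negating a sign becomes
  subtracting its bit from 1.\<close>

lemma walsh_bit_row:
  assumes "top_power j k"
  shows "i < k \<Longrightarrow> walsh_bit (j - k) i = walsh_bit j i"
    and "0 < k \<Longrightarrow> k \<le> i \<Longrightarrow> walsh_bit j i = 1 - walsh_bit j (i - k)"
    and "k = 0 \<Longrightarrow> walsh_bit j i = 1"
proof -
  show "walsh_bit (j - k) i = walsh_bit j i" if "i < k"
    using assms that walsh_minus_top[of _ j i] by (auto simp: top_power_def walsh_bit_def)
  show "walsh_bit j i = 1 - walsh_bit j (i - k)" if k: "0 < k" "k \<le> i"
  proof -
    obtain l where "k = 2 ^ l" "k \<le> j" "j < 2 * k"
      using assms k unfolding top_power_def by auto
    then have "walsh j i = - walsh j (i - k)"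
      using walsh_antiperiodic[of l j "i - k"] k by simp
    then show ?thesis
      using walsh_eq_1_or[of j "i - k"] by (auto simp: walsh_bit_def)
  qed
  show "walsh_bit j i = 1" if "k = 0"
    using assms that by (auto simp: top_power_def walsh_bit_def)
qed

text \<open>This is the state before row \<open>j\<close> is processed: cells 6 and 8 still belong
  to row \<open>j - 1\<close> until \<open>start_row\<close> updates them. For \<open>j = 0\<close>
  untouched memory takes the place of a previous row.\<close>

definition row_state :: "nat \<Rightarrow> (nat set \<Rightarrow> real) \<Rightarrow> nat \<Rightarrow> nat \<Rightarrow> state \<Rightarrow> bool" where
  "row_state n f N j s \<longleftrightarrow>
    nmem s 0 = n \<and> nmem s 1 = 1 \<and> nmem s 2 = Suc n \<and> nmem s 3 = N \<and> nmem s 5 = j \<and>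
    nmem s 7 = 20 + j * Suc n \<and> nmem s 11 = 0 \<and>
    (if j = 0 then nmem s 6 = 0 \<and> (\<forall>c\<ge>20. nmem s c = 0)
     else top_power (j - 1) (nmem s 6) \<and> nmem s 8 = 20 + (j - 1 - nmem s 6) * Suc n) \<and>
    (\<forall>j'<j. \<forall>i\<le>n. nmem s (20 + j' * Suc n + i) = walsh_bit j' i) \<and>
    rmem s 0 = f {} \<and> (\<forall>i\<in>{1..n}. rmem s i = correlation n f j i) \<and>
    queries s = {} # map (query_set n) [0..<j]"

lemma effect_start_row:
  assumes "row_state n f N j s" and s': "s' = effect n f start_row s"
  shows "top_power j (nmem s' 6)" "nmem s' 8 = 20 + (j - nmem s' 6) * Suc n"
    "nmem s' 4 = 0" "rmem s' = rmem s" "queries s' = queries s"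
    "c \<noteq> 4 \<Longrightarrow> c \<noteq> 6 \<Longrightarrow> c \<noteq> 8 \<Longrightarrow> c \<noteq> 10 \<Longrightarrow> nmem s' c = nmem s c"
proof -
  have s: "nmem s 5 = j" "nmem s 11 = 0" "nmem s 2 = Suc n" "j = 0 \<Longrightarrow> nmem s 6 = 0"
      "j > 0 \<Longrightarrow> top_power (j - 1) (nmem s 6) \<and> nmem s 8 = 20 + (j - 1 - nmem s 6) * Suc n"
    using assms(1) by (auto simp: row_state_def split: if_splits)
  show "nmem s' 4 = 0" "rmem s' = rmem s" "queries s' = queries s"
    "c \<noteq> 4 \<Longrightarrow> c \<noteq> 6 \<Longrightarrow> c \<noteq> 8 \<Longrightarrow> c \<noteq> 10 \<Longrightarrow> nmem s' c = nmem s c"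
    by (auto simp: s' start_row_def)
  have "top_power j (nmem s' 6) \<and> nmem s' 8 = 20 + (j - nmem s' 6) * Suc n"
  proof (cases j)
    case 0
    then show ?thesis using s by (simp add: s' start_row_def top_power_def)
  next
    case (Suc j')
    then have top: "top_power j' (nmem s 6)" and q: "nmem s 8 = 20 + (j' - nmem s 6) * Suc n"
      using s(5) by auto
    show ?thesis
    proof (cases "j < 2 * nmem s 6")
      case True
      then have "nmem s 6 \<le> j'"
        using top by (auto simp: top_power_def)
      then have "j - nmem s 6 = Suc (j' - nmem s 6)"
        using Suc by simp
      then show ?thesis
        using s True Suc q top_power_Suc(1)[OF top] by (simp add: s' start_row_def)
    next
      case False
      then show ?thesis
        using s Suc top_power_Suc(2)[OF top] by (simp add: s' start_row_def)
    qed
  qed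
  then show "top_power j (nmem s' 6)" "nmem s' 8 = 20 + (j - nmem s' 6) * Suc n"
    by auto
qed

lemma reaches_row:
  assumes s: "row_state n f N j s"
  shows "reaches n f (start_row ;; fill ;; query_row ;; correlate ;; next_row) s (11 * n + 18)
    (row_state n f N (Suc j))"
proof -
  define p where "p = 20 + j * Suc n"
  have c: "nmem s 0 = n" "nmem s (Suc 0) = 1" "nmem s 2 = Suc n" "nmem s 3 = N" "nmem s 5 = j"
      "nmem s 7 = p" "nmem s 11 = 0"
    and zero: "j = 0 \<Longrightarrow> c \<ge> 20 \<Longrightarrow> nmem s c = 0"
    and rows: "j' < j \<Longrightarrow> i \<le> n \<Longrightarrow> nmem s (20 + j' * Suc n + i) = walsh_bit j' i"
    and r: "rmem s 0 = f {}" "i \<in> {1..n} \<Longrightarrow> rmem s i = correlation n f j i"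
    and qs: "queries s = {} # map (query_set n) [0..<j]" for i j' c
    using s by (auto simp: row_state_def p_def)
  have "reaches n f (start_row ;; fill ;; query_row ;; correlate ;; next_row) s
      (5 + ((6 * Suc n + 1) + (3 + ((5 * n + 1) + 2)))) (row_state n f N (Suc j))"
  proof (rule reaches_Seq)
    show "reaches n f start_row s 5 (\<lambda>s1. s1 = effect n f start_row s)"
      by (rule reaches_loop_free) (auto simp: start_row_def)
  next
    fix s1 :: state
    assume s1_def: "s1 = effect n f start_row s"
    note s1 = effect_start_row[OF s s1_def]
    define k where "k = nmem s1 6"
    define q where "q = 20 + (j - k) * Suc n"
    have top: "top_power j k"
      using s1(1) by (simp add: k_def)
    show "reaches n f (fill ;; query_row ;; correlate ;; next_row) s1
        ((6 * Suc n + 1) + (3 + ((5 * n + 1) + 2))) (row_state n f N (Suc j))"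
    proof (rule reaches_Seq, rule reaches_fill)
      show "nmem s1 1 = 1" "nmem s1 2 = Suc n" "nmem s1 4 = 0" "nmem s1 6 = k" "nmem s1 7 = p"
        "nmem s1 8 = q" "nmem s1 11 = 0"
        using s1 c by (auto simp: k_def q_def)
      show "20 \<le> q" "20 \<le> p"
        by (auto simp: p_def q_def)
      show "q + n < p" if "0 < k"
      proof -
        \<comment> \<open>For positive \<open>k\<close> the copied row is an earlier one, and rows
          are \<open>Suc n\<close> cells apart.\<close>
        have "Suc (j - k) \<le> j"
          using top that by (auto simp: top_power_def)
        from mult_le_mono1[OF this, of "Suc n"] show ?thesis
          by (simp add: p_def q_def)
      qed
      show "nmem s1 (q + i) = walsh_bit j i" if "i \<le> n" "i < k" for i
      proof -
        have "j - k < j"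
          using top that by (auto simp: top_power_def)
        then have "nmem s (q + i) = walsh_bit (j - k) i"
          using rows that(1) unfolding q_def by blast
        then show ?thesis
          using s1(6)[of "q + i"] walsh_bit_row(1)[OF top that(2)] by (simp add: q_def)
      qed
      show "walsh_bit j i = 1 - walsh_bit j (i - k)" if "0 < k" "k \<le> i" for i
        using walsh_bit_row(2)[OF top that] .
      show "nmem s1 (p + i) = 0 \<and> walsh_bit j i = 1" if "k = 0" for i
      proof -
        have "j = 0"
          using top that by (auto simp: top_power_def)
        then show ?thesis
          using zero[of "p + i"] s1(6)[of "p + i"] walsh_bit_row(3)[OF top that]
          by (simp add: p_def)
      qed
    next
      fix s2 :: state
      assume "rmem s2 = rmem s1 \<and> queries s2 = queries s1 \<and>
        (\<forall>i\<le>n. nmem s2 (p + i) = walsh_bit j i) \<and>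
        (\<forall>c. c \<noteq> 4 \<longrightarrow> c \<noteq> 9 \<longrightarrow> c \<noteq> 10 \<longrightarrow> c < p \<or> p + n < c \<longrightarrow> nmem s2 c = nmem s1 c)"
      then have r2: "rmem s2 = rmem s" "queries s2 = queries s"
        and row: "\<And>i. i \<le> n \<Longrightarrow> nmem s2 (p + i) = walsh_bit j i"
        and s2: "\<And>c. c \<noteq> 4 \<Longrightarrow> c \<noteq> 9 \<Longrightarrow> c \<noteq> 10 \<Longrightarrow> c < p \<or> p + n < c \<Longrightarrow> nmem s2 c = nmem s1 c"
        using s1 by auto
      have p: "20 \<le> p" by (simp add: p_def)
      have c2: "nmem s2 0 = n" "nmem s2 (Suc 0) = 1" "nmem s2 2 = Suc n" "nmem s2 3 = N"
          "nmem s2 5 = j" "nmem s2 6 = k" "nmem s2 7 = p" "nmem s2 8 = q" "nmem s2 11 = 0"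
        using s1 c p by (auto simp: s2 k_def q_def)
      have Q: "queried_set n s2 (Ind 7) = query_set n j"
        using c2 row by (auto simp: queried_set_def query_set_def walsh_bit_def split: if_splits)
      show "reaches n f (query_row ;; correlate ;; next_row) s2 (3 + ((5 * n + 1) + 2))
          (row_state n f N (Suc j))"
      proof (rule reaches_Seq)
        show "reaches n f query_row s2 3 (\<lambda>s3. s3 = effect n f query_row s2)"
          by (rule reaches_loop_free) (auto simp: query_row_def)
      next
        fix s3 :: state
        assume s3: "s3 = effect n f query_row s2"
        have n3: "nmem s3 = (nmem s2)(4 := 1)"
          and r3: "rmem s3 = (rmem s)(Suc n := 2 * f (query_set n j))"
          and q3: "queries s3 = queries s @ [query_set n j]"
          using Q c2 r2 by (auto simp: s3 query_row_def Let_def fun_upd_def)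
        show "reaches n f (correlate ;; next_row) s3 (5 * n + 1 + 2) (row_state n f N (Suc j))"
        proof (rule reaches_Seq, rule reaches_correlate)
          show "nmem s3 1 = 1" "nmem s3 2 = Suc n" "nmem s3 4 = 1" "nmem s3 7 = p" "nmem s3 11 = 0"
            "20 \<le> p"
            using c2 p by (auto simp: n3)
          show "walsh j i = (if nmem s3 (p + i) = 0 then - 1 else 1)" if "i \<in> {1..n}" for i
            using that row[of i] p walsh_eq_1_or[of j i] by (auto simp: n3 walsh_bit_def)
        next
          fix s4 :: state
          assume "queries s4 = queries s3 \<and>
            (\<forall>i\<in>{1..n}. rmem s4 i = rmem s3 i + walsh j i * rmem s3 (Suc n)) \<and>
            rmem s4 0 = rmem s3 0 \<and>
            (\<forall>c. c \<noteq> 4 \<longrightarrow> c \<noteq> 9 \<longrightarrow> c \<noteq> 10 \<longrightarrow> nmem s4 c = nmem s3 c)"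
          then have q4: "queries s4 = {} # map (query_set n) [0..<Suc j]"
            and r4: "\<And>i. i \<in> {1..n} \<Longrightarrow> rmem s4 i = correlation n f (Suc j) i" "rmem s4 0 = f {}"
            and n4: "\<And>c. c \<noteq> 4 \<Longrightarrow> c \<noteq> 9 \<Longrightarrow> c \<noteq> 10 \<Longrightarrow> nmem s4 c = nmem s2 c"
            using qs r by (auto simp: q3 r3 n3 correlation_def)
          have rows4: "nmem s4 (20 + j' * Suc n + i) = walsh_bit j' i" if "j' \<le> j" "i \<le> n" for i j'
          proof (cases "j' = j")
            case True
            then show ?thesis
              using row[OF that(2)] n4[of "p + i"] by (simp add: p_def)
          next
            case False
            then have j': "j' < j"
              using that by simp
            \<comment> \<open>An earlier row ends before \<open>p\<close>, so filling row
              \<open>j\<close> leaves it intact.\<close>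
            then have "Suc j' * Suc n \<le> j * Suc n"
              by (intro mult_le_mono1) simp
            then have "20 + j' * Suc n + i < p"
              using that by (simp add: p_def)
            then show ?thesis
              using rows[OF j' that(2)] by (simp add: n4 s2 s1(6))
          qed
          show "reaches n f next_row s4 2 (row_state n f N (Suc j))"
          proof (rule reaches_loop_free)
            show "row_state n f N (Suc j) (effect n f next_row s4)"
              using q4 r4 rows4 c2 top
              by (auto simp: row_state_def next_row_def n4 p_def q_def less_Suc_eq_le)
          qed (simp_all add: next_row_def)
        qed
      qed
    qed
  qed
  then show ?thesis
    by (rule reaches_mono) auto
qed

lemma reaches_rows:
  assumes "row_state n f N 0 s"
  shows "reaches n f rows s (N * (11 * n + 19) + 1) (row_state n f N N)"
proof -
  have "reaches n f rows s ((N - 0) * (11 * n + 18 + 1) + 1) (row_state n f N N)"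
    unfolding rows_def
  proof (rule reaches_While[where I = "row_state n f N"])
    show "holds (NLess (Dir 5) (Dir 3)) s \<and>
        reaches n f (start_row ;; fill ;; query_row ;; correlate ;; next_row) s (11 * n + 18)
          (row_state n f N (Suc j))"
      if "j < N" "row_state n f N j s" for j s
      using reaches_row[OF that(2)] that by (auto simp: row_state_def)
    show "\<not> holds (NLess (Dir 5) (Dir 3)) s" if "row_state n f N N s" for s
      using that by (simp add: row_state_def)
  qed (use assms in simp_all)
  then show ?thesis
    by (rule reaches_mono) auto
qed

section \<open>The loops before and after the row loop\<close>

lemma reaches_powers:
  assumes "nmem s 2 = Suc n" "nmem s 3 = 1"
  shows "reaches n f powers s (2 * (LEAST m. n < 2 ^ m) + 1)
    (\<lambda>s'. s' = s\<lparr>nmem := (nmem s)(3 := 2 ^ (LEAST m. n < 2 ^ m))\<rparr>)"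
proof -
  define m where "m = (LEAST m. n < 2 ^ m)"
  \<comment> \<open>Minimality of \<open>m\<close> makes the loop test hold after every
    \<open>k < m\<close> doublings.\<close>
  have m: "n < 2 ^ m" "\<And>k. k < m \<Longrightarrow> 2 ^ k \<le> n"
    unfolding m_def
    using LeastI[of "\<lambda>m. n < 2 ^ m" n] not_less_Least[of _ "\<lambda>m. n < 2 ^ m"] by (auto simp: not_less)
  have "reaches n f powers s ((m - 0) * (1 + 1) + 1) (\<lambda>s'. s' = s\<lparr>nmem := (nmem s)(3 := 2 ^ m)\<rparr>)"
    unfolding powers_def
  proof (rule reaches_While[where I = "\<lambda>k s'. s' = s\<lparr>nmem := (nmem s)(3 := 2 ^ k)\<rparr>"])
    show "s = s\<lparr>nmem := (nmem s)(3 := 2 ^ 0)\<rparr>"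
      using assms by (simp add: fun_upd_idem)
  qed (use assms m in \<open>auto intro!: reaches_loop_free simp: less_Suc_eq_le mult_2\<close>)
  then show ?thesis
    by (rule reaches_mono) (auto simp: m_def)
qed

lemma reaches_total:
  assumes "nmem s 1 = 1" "nmem s 2 = Suc n" "nmem s 4 = 1"
  shows "reaches n f total s (3 * n + 1) (\<lambda>s'. s' = s\<lparr>nmem := (nmem s)(4 := Suc n),
    rmem := (rmem s)(Suc n := rmem s (Suc n) - (\<Sum>i=1..n. rmem s i))\<rparr>)"
proof -
  have "reaches n f total s ((Suc n - 1) * (2 + 1) + 1)
    (\<lambda>s'. s' = s\<lparr>nmem := (nmem s)(4 := Suc n),
      rmem := (rmem s)(Suc n := rmem s (Suc n) - (\<Sum>i\<in>{1..<Suc n}. rmem s i))\<rparr>)"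
    unfolding total_def
  proof (rule reaches_While[where I = "\<lambda>k s'. s' = s\<lparr>nmem := (nmem s)(4 := k),
        rmem := (rmem s)(Suc n := rmem s (Suc n) - (\<Sum>i\<in>{1..<k}. rmem s i))\<rparr>"])
    show "s = s\<lparr>nmem := (nmem s)(4 := 1),
        rmem := (rmem s)(Suc n := rmem s (Suc n) - (\<Sum>i\<in>{1..<1}. rmem s i))\<rparr>"
      using assms by (simp add: fun_upd_idem)
  qed (use assms in \<open>auto intro!: reaches_loop_free simp: diff_diff_eq\<close>)
  then show ?thesis
    by (rule reaches_mono) (auto simp: atLeastLessThanSuc_atLeastAtMost)
qed

lemma reaches_correct:
  assumes "nmem s 1 = 1" "nmem s 2 = Suc n" "nmem s 3 = N" "nmem s 4 = 1"
  shows "reaches n f correct s (4 * n + 1) (\<lambda>s'. queries s' = queries s \<and> rmem s' 0 = rmem s 0 \<and>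
    (\<forall>i\<in>{1..n}. rmem s' i = (rmem s i + rmem s (Suc n)) / N))"
proof -
  define I where "I i s' \<longleftrightarrow> queries s' = queries s \<and> nmem s' = (nmem s)(4 := i) \<and>
    (\<forall>i'\<in>{1..<i}. rmem s' i' = (rmem s i' + rmem s (Suc n)) / N) \<and>
    (\<forall>c. c = 0 \<or> i \<le> c \<longrightarrow> rmem s' c = rmem s c)" for i and s' :: state
  have "reaches n f correct s ((Suc n - 1) * (3 + 1) + 1) (I (Suc n))"
    unfolding correct_def
  proof (rule reaches_While)
    show "I 1 s"
      using assms by (simp add: I_def fun_upd_idem)
  qed (use assms in \<open>auto intro!: reaches_loop_free simp: I_def less_Suc_eq\<close>)
  then show ?thesis
    by (rule reaches_mono) (auto simp: I_def)
qed


section \<open>Query count, total running time and the final assembly\<close>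

definition num_rows :: "nat \<Rightarrow> nat" where
  "num_rows n = 2 ^ (LEAST m. n < 2 ^ m)"

lemma num_rows_gt: "n < num_rows n"
  unfolding num_rows_def using LeastI[of "\<lambda>m. n < 2 ^ m" n] by simp

text \<open>By minimality half of the power is at most \<open>n\<close>, unless the power is 1. This
  makes the number of queries linear.\<close>

lemma num_rows_le: "num_rows n \<le> 2 * n + 1"
proof (cases "LEAST m. n < 2 ^ m")
  case 0
  then show ?thesis by (simp add: num_rows_def)
next
  case (Suc m)
  then have "\<not> n < 2 ^ m"
    using not_less_Least[of m "\<lambda>m. n < 2 ^ m"] by simp
  then show ?thesis by (simp add: num_rows_def Suc)
qed

text \<open>The list depends on \<open>n\<close> alone; that the query log equals it is what
  nonadaptivity means.\<close>

definition all_queries :: "nat \<Rightarrow> nat set list" where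
  "all_queries n = {} # map (query_set n) [0..<num_rows n] @ [{1..n}]"

lemma reaches_learner:
  "reaches n f learner (initial_state n) (22 * n ^ 2 + 58 * n + 34) (\<lambda>s.
    queries s = all_queries n \<and> rmem s 0 = f {} \<and>
    (\<forall>i\<in>{1..n}. rmem s i = estimate n f (num_rows n) i))"
proof -
  define m where "m = (LEAST m. n < 2 ^ m)"
  define N where "N = num_rows n"
  define s1 where "s1 = effect n f initialize (initial_state n)"
  have s1: "nmem s1 = (\<lambda>_. 0)(0 := n, 1 := 1, 2 := Suc n, 3 := 1, 7 := 20)"
      "rmem s1 = (\<lambda>_. 0)(0 := f {})" "queries s1 = [{}]"
    by (auto simp: s1_def initialize_def initial_state_def queried_set_def Let_def fun_eq_iff)
  have "reaches n f learner (initial_state n)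
      (5 + ((2 * m + 1) + ((N * (11 * n + 19) + 1) + (4 + ((3 * n + 1) + (2 + (4 * n + 1)))))))
      (\<lambda>s. queries s = all_queries n \<and> rmem s 0 = f {} \<and>
        (\<forall>i\<in>{1..n}. rmem s i = estimate n f N i))"
    unfolding learner_def
  proof (rule reaches_Seq)
    show "reaches n f initialize (initial_state n) 5 (\<lambda>s. s = s1)"
      by (rule reaches_loop_free) (auto simp: initialize_def s1_def)
  next
    fix s :: state
    assume "s = s1"
    then show "reaches n f (powers ;; rows ;; query_all ;; total ;; average ;; correct) s
        ((2 * m + 1) + ((N * (11 * n + 19) + 1) + (4 + ((3 * n + 1) + (2 + (4 * n + 1))))))
        (\<lambda>s. queries s = all_queries n \<and> rmem s 0 = f {} \<and>
          (\<forall>i\<in>{1..n}. rmem s i = estimate n f N i))"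
      unfolding m_def
    proof (hypsubst, intro reaches_Seq[OF reaches_powers] reaches_Seq[OF reaches_rows])
      show "nmem s1 2 = Suc n" "nmem s1 3 = 1"
        by (simp_all add: s1)
    next
      fix s2 :: state
      assume "s2 = s1\<lparr>nmem := (nmem s1)(3 := 2 ^ (LEAST m. n < 2 ^ m))\<rparr>"
      then show "row_state n f N 0 s2"
        by (simp add: row_state_def s1 correlation_def N_def num_rows_def)
    next
      fix s3 :: state
      assume s3: "row_state n f N N s3"
      \<comment> \<open>At least one row was built, so row 0 is in memory for the query of
        \<open>{1..n}\<close>.\<close>
      have "0 < N"
        using num_rows_gt[of n] by (simp add: N_def)
      then have c3: "nmem s3 0 = n" "nmem s3 (Suc 0) = 1" "nmem s3 2 = Suc n" "nmem s3 3 = N"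
        and row: "\<And>i. i \<le> n \<Longrightarrow> nmem s3 (20 + i) = 1"
        and r3: "rmem s3 0 = f {}" "\<And>i. i \<in> {1..n} \<Longrightarrow> rmem s3 i = correlation n f N i"
        and q3: "queries s3 = {} # map (query_set n) [0..<N]"
        using s3 unfolding row_state_def by (auto simp: walsh_bit_def)
      have Q: "queried_set n s3 (Dir 20) = {1..n}"
        using row by (auto simp: queried_set_def)
      show "reaches n f (query_all ;; total ;; average ;; correct) s3
          (4 + ((3 * n + 1) + (2 + (4 * n + 1))))
          (\<lambda>s. queries s = all_queries n \<and> rmem s 0 = f {} \<and>
            (\<forall>i\<in>{1..n}. rmem s i = estimate n f N i))"
      proof (rule reaches_Seq)
        show "reaches n f query_all s3 4 (\<lambda>s4. s4 = effect n f query_all s3)"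
          by (rule reaches_loop_free) (auto simp: query_all_def)
      next
        fix s4 :: state
        assume s4_def: "s4 = effect n f query_all s3"
        have s4: "nmem s4 = (nmem s3)(4 := 1)"
            "rmem s4 = (rmem s3)(Suc n := (f {1..n} - f {}) * N)"
            "queries s4 = all_queries n"
          using Q c3 r3 q3
          by (auto simp: s4_def query_all_def Let_def fun_upd_def all_queries_def N_def)
        show "reaches n f (total ;; average ;; correct) s4 ((3 * n + 1) + (2 + (4 * n + 1)))
            (\<lambda>s. queries s = all_queries n \<and> rmem s 0 = f {} \<and>
              (\<forall>i\<in>{1..n}. rmem s i = estimate n f N i))"
        proof (rule reaches_Seq[OF reaches_total])
          show "nmem s4 1 = 1" "nmem s4 2 = Suc n" "nmem s4 4 = 1"
            using c3 by (simp_all add: s4)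
        next
          fix s5 :: state
          assume s5_def: "s5 = s4\<lparr>nmem := (nmem s4)(4 := Suc n),
            rmem := (rmem s4)(Suc n := rmem s4 (Suc n) - (\<Sum>i=1..n. rmem s4 i))\<rparr>"
          have "(\<Sum>i=1..n. rmem s4 i) = (\<Sum>i=1..n. correlation n f N i)"
            using r3 by (intro sum.cong) (auto simp: s4)
          then have s5: "nmem s5 = (nmem s3)(4 := Suc n)"
              "rmem s5 = (rmem s3)(Suc n := N * (f {1..n} - f {}) - (\<Sum>i=1..n. correlation n f N i))"
              "queries s5 = all_queries n"
            by (auto simp: s5_def s4 mult.commute)
          show "reaches n f (average ;; correct) s5 (2 + (4 * n + 1))
            (\<lambda>s. queries s = all_queries n \<and> rmem s 0 = f {} \<and>
              (\<forall>i\<in>{1..n}. rmem s i = estimate n f N i))"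
          proof (rule reaches_Seq)
            show "reaches n f average s5 2 (\<lambda>s6. s6 = effect n f average s5)"
              by (rule reaches_loop_free) (auto simp: average_def)
          next
            fix s6 :: state
            assume s6_def: "s6 = effect n f average s5"
            have s6: "nmem s6 = (nmem s3)(4 := 1)" "queries s6 = all_queries n"
                "rmem s6 = (rmem s3)(Suc n :=
                  (N * (f {1..n} - f {}) - (\<Sum>i=1..n. correlation n f N i)) / n)"
              using c3 by (auto simp: s6_def average_def s5)
            show "reaches n f correct s6 (4 * n + 1)
              (\<lambda>s. queries s = all_queries n \<and> rmem s 0 = f {} \<and>
                (\<forall>i\<in>{1..n}. rmem s i = estimate n f N i))"
              by (rule reaches_mono[OF reaches_correct[of s6 n N]])
                (use c3 r3 in \<open>auto simp: s6 estimate_def\<close>)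
          qed
        qed
      qed
    qed
  qed
  moreover have "5 + ((2 * m + 1) + ((N * (11 * n + 19) + 1) +
      (4 + ((3 * n + 1) + (2 + (4 * n + 1)))))) \<le> 22 * n ^ 2 + 58 * n + 34"
  proof -
    have "m \<le> n"
      unfolding m_def by (rule Least_le) simp
    \<comment> \<open>The other summands are at most \<open>9 * n + 15\<close>, by
      \<open>m \<le> n\<close>; adding the expanded product gives the stated quadratic.\<close>
    moreover have "N * (11 * n + 19) \<le> (2 * n + 1) * (11 * n + 19)"
      using num_rows_le[of n] by (intro mult_le_mono1) (simp add: N_def)
    ultimately show ?thesis
      by (simp add: power2_eq_square algebra_simps)
  qed
  ultimately show ?thesis
    unfolding N_def by (rule reaches_mono)
qed

text \<open>\<open>Q\<close> is chosen before \<open>f\<close>, which expresses nonadaptivity, and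
  \<open>\<Delta>\<close> comes after the run, so the algorithm is not told it.\<close>

theorem theorem4:
  "\<exists>(P :: prog) (p :: nat poly) (Q :: nat \<Rightarrow> nat set list) (C :: real).
     (\<lambda>n. real (length (Q n))) \<in> O(\<lambda>n. real n) \<and>
     (\<forall>(n :: nat) (f :: nat set \<Rightarrow> real). \<exists>t s.
        runs n f P (initial_state n) t s \<and>
        t \<le> poly p n \<and>
        queries s = Q n \<and>
        linear_set_function n (output_function s) \<and>
        (\<forall>\<Delta> :: real. delta_linear n \<Delta> f \<longrightarrow>
           (\<forall>S. S \<subseteq> {1..n} \<longrightarrow>
              \<bar>output_function s S - f S\<bar>
                \<le> C * (\<Delta> * (1 + sqrt (min (real (card S)) (real n - real (card S))))))))"
\<comment> \<open>The polynomial lists the coefficients of the time bound in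
  \<open>reaches_learner\<close> from the constant term up; 6 is the constant of
  \<open>approximation_error\<close>.\<close>
proof (rule exI[of _ learner], rule exI[of _ "[:34, 58, 22:]"], rule exI[of _ all_queries],
    rule exI[of _ 6], intro conjI allI)
  show "(\<lambda>n. real (length (all_queries n))) \<in> O(\<lambda>n. real n)"
  \<comment> \<open>There are \<open>num_rows n + 2\<close> queries, at most
    \<open>2 * n + 3\<close>, hence at most \<open>5 * n\<close> from \<open>n = 1\<close>
    on.\<close>
  proof (rule bigoI[of _ 5], rule eventually_sequentiallyI[of 1])
    fix n :: nat
    assume "1 \<le> n"
    then show "norm (real (length (all_queries n))) \<le> 5 * norm (real n)"
      using num_rows_le[of n] by (simp add: all_queries_def)
  qed
next
  fix n :: nat and f :: "nat set \<Rightarrow> real"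
  obtain t s where run: "runs n f learner (initial_state n) t s" "t \<le> 22 * n ^ 2 + 58 * n + 34"
    and queries: "queries s = all_queries n"
    and out: "rmem s 0 = f {}" "\<And>i. i \<in> {1..n} \<Longrightarrow> rmem s i = estimate n f (num_rows n) i"
    using reaches_learner[of n f] unfolding reaches_def by blast
  have "output_function s S = f {} + (\<Sum>i\<in>S. estimate n f (num_rows n) i)" if "S \<subseteq> {1..n}" for S
    unfolding output_function_def out(1) using that
    by (intro arg_cong2[of _ _ _ _ "(+)"] sum.cong out) auto
  then have "\<forall>\<Delta>. delta_linear n \<Delta> f \<longrightarrow> (\<forall>S. S \<subseteq> {1..n} \<longrightarrow> \<bar>output_function s S - f S\<bar>
      \<le> 6 * (\<Delta> * (1 + sqrt (min (real (card S)) (real n - real (card S))))))"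
    using approximation_error[of n "LEAST m. n < 2 ^ m" _ _ f] num_rows_gt[of n]
    by (simp add: num_rows_def)
  moreover have "t \<le> poly [:34, 58, 22:] n"
    using run(2) by (simp add: power2_eq_square algebra_simps)
  ultimately show "\<exists>t s. runs n f learner (initial_state n) t s \<and> t \<le> poly [:34, 58, 22:] n \<and>
      queries s = all_queries n \<and> linear_set_function n (output_function s) \<and>
      (\<forall>\<Delta>. delta_linear n \<Delta> f \<longrightarrow> (\<forall>S. S \<subseteq> {1..n} \<longrightarrow> \<bar>output_function s S - f S\<bar>
        \<le> 6 * (\<Delta> * (1 + sqrt (min (real (card S)) (real n - real (card S)))))))"
    using run(1) queries linear_output_function by blast
qed

end
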